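(* Let $n$ be a positive integer, let $\mathbb{F}$ be a field, and let $\mathcal{V}\subseteq\mathbb{F}^n$ be a finite subset of the affine space $\mathbb{F}^n$. Suppose that there exists a finite subgroup $G\leq\mathrm{Aff}(\mathbb{F},n)$ such that $G$ is a transitive subgroup of the symmetric group $\mathrm{Sym}(\mathcal{V})$. Then the function $AC(\mathcal{V},\cdot):\mathcal{V}\to\mathbb{N}$ is constant, i.e., $AC(\mathcal{V},\mathbf{v})=AC(\mathcal{V},\mathbf{w})$ for all $\mathbf{v}\neq\mathbf{w}\in\mathcal{V}$.
   Context: $\mathrm{Aff}(\mathbb{F},n)$ is the group of affine isomorphisms of $\mathbb{F}^n$, and $\mathrm{Sym}(\mathcal{V})$ is the group of all permutations of $\mathcal{V}$. That $G$ is a transitive subgroup of $\mathrm{Sym}(\mathcal{V})$ means that every $g\in G$ maps $\mathcal{V}$ onto itself and that $G$, regarded via restriction to $\mathcal{V}$ as a group of permutations of $\mathcal{V}$, acts transitively on $\mathcal{V}$. For a finite set of points $\mathcal{V}\subseteq\mathbb{F}^n$ and $\mathbf{v}\in\mathcal{V}$, a finite (possibly empty) set of affine hyperplanes $\{H_1,\ldots,H_m\}$ of $\mathbb{F}^n$ is an almost cover of $\mathcal{V}$ and $\mathbf{v}$ if the union $\bigcup_{j=1}^m H_j$ contains $\mathcal{V}\setminus\{\mathbf{v}\}$ but does not contain $\mathbf{v}$. $AC(\mathcal{V},\mathbf{v})$ denotes the minimum size (number of hyperplanes) of an almost cover of $\mathcal{V}$ and $\mathbf{v}$. *)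

theory Defs
  imports "HOL-Analysis.Cartesian_Space" "HOL-Algebra.Group_Action"
begin

definition Aff :: "(('a::field, 'n::finite) vec \<Rightarrow> ('a, 'n) vec) monoid" where
  "Aff = (BijGroup UNIV)\<lparr>carrier :=
     {f. \<exists>L c. Vector_Spaces.linear (*s) (*s) L \<and> bij L \<and> f = (\<lambda>x. L x + c)}\<rparr>"

definition affine_hyperplane :: "('a::field ^ 'n) set \<Rightarrow> bool" where
  "affine_hyperplane H \<longleftrightarrow>
     (\<exists>W p. vec.subspace W \<and> vec.dim W = CARD('n) - 1 \<and> H = (\<lambda>x. p + x) ` W)"

definition almost_cover ::
    "('a::field ^ 'n) set \<Rightarrow> 'a ^ 'n \<Rightarrow> ('a ^ 'n) set set \<Rightarrow> bool" where
  "almost_cover V v C \<longleftrightarrow>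
     finite C \<and> (\<forall>H\<in>C. affine_hyperplane H) \<and> V - {v} \<subseteq> \<Union>C \<and> v \<notin> \<Union>C"

text \<open>The minimum is attained by lemma \<open>almost_cover_exists\<close> below.\<close>

definition AC :: "('a::field ^ 'n) set \<Rightarrow> 'a ^ 'n \<Rightarrow> nat" where
  "AC V v = (LEAST m. \<exists>C. almost_cover V v C \<and> card C = m)"

lemma group_Aff: "group (Aff :: (('a::field, 'n::finite) vec \<Rightarrow> ('a, 'n) vec) monoid)"
proof -
  let ?A = "carrier (Aff :: (('a, 'n) vec \<Rightarrow> ('a, 'n) vec) monoid)"
  interpret B: group "BijGroup (UNIV :: ('a, 'n) vec set)" by (rule group_BijGroup)
  have cA: "?A = {f. \<exists>L c. Vector_Spaces.linear (*s) (*s) L \<and> bij L \<and> f = (\<lambda>x. L x + c)}"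
    by (simp add: Aff_def)
  have bij: "bij f" if "f \<in> ?A" for f
  proof -
    from that obtain L c where "bij L" "f = (\<lambda>x. x + c) \<circ> L" by (auto simp: cA fun_eq_iff)
    then show ?thesis by (auto intro!: bij_comp simp: bij_plus_right)
  qed
  have mult: "f \<otimes>\<^bsub>BijGroup UNIV\<^esub> g = f \<circ> g" if "bij f" "bij g" for f g :: "('a, 'n) vec \<Rightarrow> ('a, 'n) vec"
    using that by (simp add: BijGroup_def Bij_def compose_def fun_eq_iff)
  have sub: "?A \<subseteq> carrier (BijGroup UNIV)"
    using bij by (auto simp: BijGroup_def Bij_def)
  have comp: "f \<circ> g \<in> ?A" if f: "f \<in> ?A" and g: "g \<in> ?A" for f g
  proof -
    from f obtain L c where L: "Vector_Spaces.linear (*s) (*s) L" "bij L" "f = (\<lambda>x. L x + c)"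
      unfolding cA by blast
    from g obtain M d where M: "Vector_Spaces.linear (*s) (*s) M" "bij M" "g = (\<lambda>x. M x + d)"
      unfolding cA by blast
    have "f \<circ> g = (\<lambda>x. (L \<circ> M) x + (L d + c))"
      using L(3) M(3) vec.linear_add[OF L(1)] by (simp add: fun_eq_iff add.assoc)
    moreover have "Vector_Spaces.linear (*s) (*s) (L \<circ> M)"
      using L(1) M(1) by (simp add: linear_compose Vector_Spaces.linear_compose)
    ultimately show ?thesis unfolding cA using bij_comp[OF M(2) L(2)] by blast
  qed
  have invA: "\<exists>g\<in>?A. g \<circ> f = id" if f: "f \<in> ?A" for f
  proof -
    from f obtain L c where L: "Vector_Spaces.linear (*s) (*s) L" "bij L" "f = (\<lambda>x. L x + c)"
      unfolding cA by blast
    obtain M where M: "Vector_Spaces.linear (*s) (*s) M" "M \<circ> L = id"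
      using vec.linear_injective_left_inverse[OF L(1)] L(2) by (auto simp: bij_def)
    have "bij M" using L(2) M(2) by (metis bij_betw_comp_iff bij_id)
    moreover have "(\<lambda>x. M x + - M c) \<circ> f = id"
      using M(2) L(3) vec.linear_add[OF M(1)] by (simp add: fun_eq_iff)
    ultimately show ?thesis unfolding cA using M(1) by blast
  qed
  have one: "id \<in> ?A" unfolding cA
    by (auto intro!: exI[of _ id] exI[of _ 0] simp: vec.linear_id fun_eq_iff)
  show ?thesis
  proof (rule groupI)
    have Aeq: "x \<otimes>\<^bsub>Aff\<^esub> y = x \<circ> y" if "x \<in> ?A" "y \<in> ?A" for x y
      using mult[OF bij[OF that(1)] bij[OF that(2)]] by (simp add: Aff_def)
    have oneeq: "\<one>\<^bsub>Aff :: (('a, 'n) vec \<Rightarrow> ('a, 'n) vec) monoid\<^esub> = id"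
      by (simp add: Aff_def BijGroup_def fun_eq_iff)
    show "x \<otimes>\<^bsub>Aff\<^esub> y \<in> ?A" if "x \<in> ?A" "y \<in> ?A" for x y
      using comp Aeq that by simp
    show "\<one>\<^bsub>Aff\<^esub> \<in> ?A" using one oneeq by simp
    show "x \<otimes>\<^bsub>Aff\<^esub> y \<otimes>\<^bsub>Aff\<^esub> z = x \<otimes>\<^bsub>Aff\<^esub> (y \<otimes>\<^bsub>Aff\<^esub> z)"
      if "x \<in> ?A" "y \<in> ?A" "z \<in> ?A" for x y z
      using that by (simp add: Aeq comp comp_assoc)
    show "\<one>\<^bsub>Aff\<^esub> \<otimes>\<^bsub>Aff\<^esub> x = x" if "x \<in> ?A" for x
      using that by (simp add: oneeq Aeq one)
    show "\<exists>y\<in>?A. y \<otimes>\<^bsub>Aff\<^esub> x = \<one>\<^bsub>Aff\<^esub>" if "x \<in> ?A" for x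
      using invA[OF that] that by (auto simp: oneeq Aeq)
  qed
qed

lemma affine_hyperplane_separates:
  fixes v w :: "'a::field ^ 'n"
  assumes "w \<noteq> v"
  shows "\<exists>H. affine_hyperplane H \<and> w \<in> H \<and> v \<notin> H"
proof -
  obtain i where i: "w $ i \<noteq> v $ i" using assms by (auto simp: vec_eq_iff)
  let ?B = "(\<lambda>j. axis j (1::'a)) ` (- {i}) :: ('a ^ 'n) set"
  let ?W = "vec.span ?B"
  have "vec.independent ?B"
    by (rule vec.independent_mono[OF independent_cart_basis]) (auto simp: cart_basis_def)
  then have "vec.dim ?W = card ?B"
    by (simp add: vec.dim_eq_card_independent)
  also have "\<dots> = CARD('n) - 1"
    by (subst card_image) (auto simp: inj_on_def axis_eq_axis Compl_eq_Diff_UNIV card_Diff_singleton)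
  finally have dim: "vec.dim ?W = CARD('n) - 1" .
  have zero: "x $ i = 0" if "x \<in> ?W" for x
    using that by (induction rule: vec.span_induct_alt) (auto simp: axis_def)
  let ?H = "(\<lambda>x. w + x) ` ?W"
  have "affine_hyperplane ?H"
    unfolding affine_hyperplane_def using vec.subspace_span dim by blast
  moreover have "w \<in> ?H" using vec.span_zero by (force intro: image_eqI[of _ _ 0])
  moreover have "v \<notin> ?H" using zero i by auto
  ultimately show ?thesis by blast
qed

lemma almost_cover_exists:
  assumes "finite V"
  shows "\<exists>C. almost_cover V v C"
proof -
  obtain h where "affine_hyperplane (h w) \<and> w \<in> h w \<and> v \<notin> h w" if "w \<noteq> v" for w
    using affine_hyperplane_separates by metis
  with assms have "almost_cover V v (h ` (V - {v}))"
    by (auto simp: almost_cover_def)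
  then show ?thesis by blast
qed

end

theory Submission
  imports Defs
begin

text \<open>An affine bijection sends hyperplanes to hyperplanes, so it turns an almost cover of
  \<open>V\<close> and \<open>v\<close> into one of \<open>f\<close> V\<open>and\<close>f
  v\<open>with no more members (\<close>almost_cover_image\<open>); hence\<close>AC (f
  \<open>V) (f v)\<close> is at most \<open>AC V v\<close> (\<open>AC_image_le\<close>). An element
  of \<open>G\<close> maps \<open>V\<close> onto itself, and by transitivity one can be chosen to
  send \<open>v\<close> to \<open>w\<close>, so \<open>AC V w\<close> is at most
  \<open>AC V v\<close>. Exchanging the two points gives equality.\<close>

lemma bij_Aff:
  assumes "f \<in> carrier Aff"
  shows "bij f"
proof -
  obtain L c where "bij L" "f = (\<lambda>x. x + c) \<circ> L"
    using assms by (auto simp: Aff_def fun_eq_iff)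
  then show ?thesis by (auto intro!: bij_comp simp: bij_plus_right)
qed

text \<open>The linear part \<open>L\<close> acts on the direction space, whose dimension it
  preserves by injectivity; the translation only moves the base point, to
  \<open>L p + c\<close>.\<close>

lemma affine_hyperplane_image:
  fixes f :: "'a::field ^ 'n \<Rightarrow> 'a ^ 'n"
  assumes "f \<in> carrier Aff" and "affine_hyperplane H"
  shows "affine_hyperplane (f ` H)"
proof -
  obtain L c where L: "Vector_Spaces.linear (*s) (*s) L" "bij L" and f: "f = (\<lambda>x. L x + c)"
    using assms(1) by (auto simp: Aff_def)
  obtain W p where W: "vec.subspace W" "vec.dim W = CARD('n) - 1" and H: "H = (\<lambda>x. p + x) ` W"
    using assms(2) unfolding affine_hyperplane_def by blast
  have "vec.subspace (L ` W)"
    using L(1) W(1) by (rule vec.linear_subspace_image)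
  moreover have "vec.dim (L ` W) = CARD('n) - 1"
    using vec.dim_image_eq[OF L(1), of W] L(2) W(2)
    by (metis bij_is_inj inj_on_subset subset_UNIV)
  moreover have "f ` H = (\<lambda>x. (L p + c) + x) ` (L ` W)"
    unfolding H f image_image using vec.linear_add[OF L(1)] by (simp add: ac_simps)
  ultimately show ?thesis
    unfolding affine_hyperplane_def by blast
qed

text \<open>Injectivity keeps \<open>f v\<close> outside the images of the hyperplanes and lets the
  image commute with removing \<open>v\<close>.\<close>

lemma almost_cover_image:
  assumes f: "f \<in> carrier Aff" and C: "almost_cover V v C"
  shows "almost_cover (f ` V) (f v) ((`) f ` C)"
proof -
  have "inj f" using bij_Aff[OF f] by (rule bij_is_inj)
  moreover have "f ` (V - {v}) \<subseteq> f ` \<Union>C"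
    using C unfolding almost_cover_def by (intro image_mono) blast
  ultimately show ?thesis
    using C affine_hyperplane_image[OF f]
    by (auto simp: almost_cover_def image_set_diff image_Union inj_image_mem_iff)
qed

lemma AC_image_le:
  assumes "finite V" and "f \<in> carrier Aff"
  shows "AC (f ` V) (f v) \<le> AC V v"
proof -
  \<comment> \<open>Finiteness of \<open>V\<close> provides some almost cover, so the
    \<open>LEAST\<close> in \<open>AC\<close> is attained.\<close>
  have "\<exists>m C. almost_cover V v C \<and> card C = m"
    using almost_cover_exists[OF assms(1)] by blast
  then have "\<exists>C. almost_cover V v C \<and> card C = AC V v"
    unfolding AC_def by (rule LeastI_ex)
  then obtain C where C: "almost_cover V v C" "card C = AC V v"
    by blast
  have "AC (f ` V) (f v) \<le> card ((`) f ` C)"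
    unfolding AC_def using almost_cover_image[OF assms(2) C(1)] by (blast intro: Least_le)
  also have "\<dots> \<le> AC V v"
    using C by (metis almost_cover_def card_image_le)
  finally show ?thesis .
qed

theorem theorem1p9:
  fixes V :: "('a::field ^ 'n) set"
  assumes "finite V"
    and "\<exists>G. subgroup G Aff \<and> finite G \<and>
           transitive_action (Aff\<lparr>carrier := G\<rparr>) V (\<lambda>g. restrict g V)"
  shows "\<forall>v\<in>V. \<forall>w\<in>V. v \<noteq> w \<longrightarrow> AC V v = AC V w"
proof -
  obtain G where G: "subgroup G Aff"
    and act: "transitive_action (Aff\<lparr>carrier := G\<rparr>) V (\<lambda>g. restrict g V)"
    using assms(2) by blast
  interpret transitive_action "Aff\<lparr>carrier := G\<rparr>" V "\<lambda>g. restrict g V"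
    by (rule act)
  have "AC V w \<le> AC V v" if vw: "v \<in> V" "w \<in> V" for v w
  proof -
    obtain g where g: "g \<in> G" "g v = w"
      using unique_orbit[OF vw] vw by auto
    have "g ` V = V"
      using surj_prop[of g] g(1) by simp
    then show ?thesis
      using AC_image_le[OF assms(1), of g v] subgroup.mem_carrier[OF G g(1)] g(2) by simp
  qed
  \<comment> \<open>The inequality holds for every ordered pair of points, so it can be used in both
    directions.\<close>
  then show ?thesis by (blast intro: antisym)
qed

end
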